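(* Let $q$ be a prime power and let $n,d$ be integers with $n \ge 2$ and $2 \le d \le n$. Then $$\limsup_{m \to +\infty} \, \delta_q(n \times m, m(n-d+1),d) \le \frac{1}{\binom{n}{d-1}_q\left(\pi(q)-1\right)+1}.$$
   Context: Here $q,n,d$ are fixed and the limit superior is over integers $m \ge n$. The $q$-binomial coefficient is $\binom{a}{b}_q = \prod_{i=0}^{b-1} \frac{q^a-q^i}{q^b-q^i}$, and $\pi(q) := \prod_{i=1}^{\infty}\frac{q^i}{q^i-1}$. A (rank-metric) code is a non-zero $\mathbb{F}_q$-linear subspace $\mathcal{C}$ of the space $\mathbb{F}_q^{n\times m}$ of $n \times m$ matrices; its minimum distance is $d(\mathcal{C})=\min\{\mathrm{rk}(M) \mid M \in \mathcal{C}, M\ne 0\}$. For $1\le k\le mn$ and $1 \le d \le n$, $$\delta_q(n \times m, k, d):= \frac{|\{\mathcal{C} \le \mathbb{F}_q^{n\times m} \mid \dim(\mathcal{C})=k, \; d(\mathcal{C}) \ge d\}|}{\binom{mn}{k}_q}.$$ *)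

theory Defs
  imports
    "HOL-Library.Extended_Real"
    "HOL-Analysis.Infinite_Products"
    "HOL-Number_Theory.Prime_Powers"
    "Jordan_Normal_Form.DL_Rank"
begin

definition q_binomial :: "real \<Rightarrow> nat \<Rightarrow> nat \<Rightarrow> real" where
  "q_binomial q a b = (\<Prod>i<b. (q ^ a - q ^ i) / (q ^ b - q ^ i))"

text \<open>The infinite product over \<open>i \<ge> 1\<close>; the library's products start at 0, hence the shift.\<close>

definition q_pi :: "real \<Rightarrow> real" where
  "q_pi q = prodinf (\<lambda>i. q ^ Suc i / (q ^ Suc i - 1))"

definition mat_rank :: "'a :: field mat \<Rightarrow> nat" where
  "mat_rank M = vec_space.rank (dim_row M) M"

definition rank_metric_code :: "nat \<Rightarrow> nat \<Rightarrow> 'a :: field mat set \<Rightarrow> bool" where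
  "rank_metric_code n m C \<longleftrightarrow>
     subspace class_ring C (module_mat TYPE('a) n m) \<and> C \<noteq> {0\<^sub>m n m}"

definition code_dim :: "nat \<Rightarrow> nat \<Rightarrow> 'a :: field mat set \<Rightarrow> nat" where
  "code_dim n m C =
     vectorspace.dim class_ring ((module_mat TYPE('a) n m)\<lparr>carrier := C\<rparr>)"

text \<open>The set of ranks is finite, and it is nonempty whenever \<open>C\<close> is a (non-zero) code.\<close>

definition min_distance :: "nat \<Rightarrow> nat \<Rightarrow> 'a :: field mat set \<Rightarrow> nat" where
  "min_distance n m C = Min {mat_rank M | M. M \<in> C \<and> M \<noteq> 0\<^sub>m n m}"

text \<open>
  The field \<open>F\<^sub>q\<close> is the type argument, so \<open>q = CARD('a)\<close>.
  For \<open>k \<ge> 1\<close> every \<open>k\<close>-dimensional subspace is non-zero, so counting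
  codes instead of subspaces excludes nothing.
\<close>

definition code_density ::
    "'a :: {finite, field} itself \<Rightarrow> nat \<Rightarrow> nat \<Rightarrow> nat \<Rightarrow> nat \<Rightarrow> real" where
  "code_density _ n m k d =
     real (card {C :: 'a mat set.
       rank_metric_code n m C \<and> code_dim n m C = k \<and> min_distance n m C \<ge> d})
     / q_binomial (real CARD('a)) (m * n) k"

end

theory Submission
  imports Defs "HOL-Library.Function_Algebras"
begin

text \<open>
  Let \<open>C\<close> be a uniformly random subspace of dimension \<open>k = m (n - d + 1)\<close> of the space of
  \<open>n \<times> m\<close> matrices. For a subspace \<open>U\<close> of the column space of dimension \<open>d - 1\<close>, let \<open>A\<^sub>U\<close> be the
  space of matrices with all columns in \<open>U\<close>; its dimension is \<open>a = m (d - 1) = mn - k\<close>. All nonzero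
  matrices in \<open>A\<^sub>U\<close> have rank less than \<open>d\<close>, so a code of minimum distance at least \<open>d\<close> is a common
  complement of all \<open>A\<^sub>U\<close>. There are \<open>N = q_binomial q n (d - 1)\<close> spaces \<open>A\<^sub>U\<close>. The number \<open>Y\<close> of
  those that meet \<open>C\<close> trivially is therefore equal to \<open>N\<close> for every such code, and
  the second moment method bounds the probability of this event:
  \<open>P(Y = N) (N - L)\<^sup>2 \<le> E (Y - L)\<^sup>2\<close> for every constant \<open>L\<close> (lemma \<open>second_moment_bound\<close>).

  The moments of \<open>Y\<close> come from counting complements. A single space of dimension \<open>a\<close> has exactly
  \<open>q\<^bsup>ak\<^esup>\<close> complements (\<open>card_complements\<close>), so it meets \<open>C\<close> trivially with a probability that tends to
  \<open>1 / \<pi>(q)\<close>. Given this, a second space whose intersection with the first has codimension \<open>r\<close> in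
  either meets \<open>C\<close> trivially with probability at most \<open>(1 - q\<^bsup>-1\<^esup>) \<dots> (1 - q\<^bsup>-r\<^esup>)\<close>
  (\<open>card_common_complements_le\<close>). For different \<open>U\<close> one has \<open>r \<ge> m\<close>, so the limit superior of this
  conditional probability is at most \<open>1 / \<pi>(q)\<close>. Hence the bound has the same limit as for \<open>N\<close>
  pairwise independent events of probability \<open>1 / \<pi>(q)\<close>. With the optimal \<open>L = (N - 1) / \<pi>(q)\<close>
  this limit equals \<open>1 / (N (\<pi>(q) - 1) + 1)\<close>.
\<close>

section \<open>The second moment method\<close>

text \<open>
  If every \<open>c\<close> is counted with the number \<open>Y c\<close> of sets \<open>E j\<close> that contain it, then the \<open>c\<close> lying in
  all of them contribute \<open>(card J - L)\<^sup>2\<close> each to the sum of \<open>(Y c - L)\<^sup>2\<close>, which is computed from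
  the first two moments of \<open>Y\<close>.
\<close>
lemma second_moment_bound:
  fixes E :: "'j \<Rightarrow> 'c set" and L :: real
  assumes fin: "finite \<Omega>" "finite J" and sub: "\<And>j. j \<in> J \<Longrightarrow> E j \<subseteq> \<Omega>"
    and e1: "\<And>j. j \<in> J \<Longrightarrow> real (card (E j)) = e"
    and e2: "\<And>i j. i \<in> J \<Longrightarrow> j \<in> J \<Longrightarrow> i \<noteq> j \<Longrightarrow> real (card (E i \<inter> E j)) \<le> e'"
  shows "real (card {c \<in> \<Omega>. \<forall>j\<in>J. c \<in> E j}) * (real (card J) - L)\<^sup>2
    \<le> real (card J) * e + real (card J) * (real (card J) - 1) * e'
      - 2 * L * real (card J) * e + L\<^sup>2 * real (card \<Omega>)"
proof -
  define Y where "Y c = (\<Sum>j\<in>J. indicator (E j) c :: real)" for c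
  let ?N = "real (card J)"
  let ?T = "{c \<in> \<Omega>. \<forall>j\<in>J. c \<in> E j}"
  have ind: "(\<Sum>c\<in>\<Omega>. indicator A c) = real (card A)" if "A \<subseteq> \<Omega>" for A
    using that fin by (simp add: indicator_def sum.If_cases Int_absorb1)
  have "real (card ?T) * (?N - L)\<^sup>2 = (\<Sum>c\<in>?T. (Y c - L)\<^sup>2)"
    by (simp add: Y_def)
  also have "\<dots> \<le> (\<Sum>c\<in>\<Omega>. (Y c - L)\<^sup>2)"
    using fin by (intro sum_mono2) auto
  also have "\<dots> = (\<Sum>c\<in>\<Omega>. (Y c)\<^sup>2) - 2 * L * (\<Sum>c\<in>\<Omega>. Y c) + L\<^sup>2 * real (card \<Omega>)"
    by (simp add: power2_diff sum.distrib sum_subtractf sum_distrib_left sum_distrib_right mult_ac)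
  also have "(\<Sum>c\<in>\<Omega>. Y c) = ?N * e"
    unfolding Y_def by (subst sum.swap) (simp add: ind sub e1)
  also have "(\<Sum>c\<in>\<Omega>. (Y c)\<^sup>2) = (\<Sum>i\<in>J. \<Sum>j\<in>J. real (card (E i \<inter> E j)))"
  proof -
    have "(\<Sum>c\<in>\<Omega>. (Y c)\<^sup>2) = (\<Sum>c\<in>\<Omega>. \<Sum>i\<in>J. \<Sum>j\<in>J. indicator (E i \<inter> E j) c)"
      by (simp add: Y_def power2_eq_square sum_product indicator_inter_arith)
    also have "\<dots> = (\<Sum>i\<in>J. \<Sum>j\<in>J. \<Sum>c\<in>\<Omega>. indicator (E i \<inter> E j) c)"
      by (subst sum.swap, rule sum.cong[OF refl], rule sum.swap)
    also have "\<dots> = (\<Sum>i\<in>J. \<Sum>j\<in>J. real (card (E i \<inter> E j)))"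
      by (intro sum.cong refl ind) (use sub in blast)
    finally show ?thesis .
  qed
  also have "\<dots> \<le> (\<Sum>i\<in>J. e + (?N - 1) * e')"
  proof (rule sum_mono)
    fix i assume i: "i \<in> J"
    have "(\<Sum>j\<in>J. real (card (E i \<inter> E j)))
        = real (card (E i)) + (\<Sum>j\<in>J - {i}. real (card (E i \<inter> E j)))"
      using i fin by (subst sum.remove[of _ i]) auto
    also have "\<dots> \<le> e + (\<Sum>j\<in>J - {i}. e')"
      using e1[OF i] e2[OF i] by (intro add_mono sum_mono) auto
    also have "(\<Sum>j\<in>J - {i}. e') = (?N - 1) * e'"
    proof -
      have "card J \<ge> 1" using i fin by (auto simp: Suc_le_eq card_gt_0_iff)
      then show ?thesis using i fin by (simp add: of_nat_diff)
    qed
    finally show "(\<Sum>j\<in>J. real (card (E i \<inter> E j))) \<le> e + (?N - 1) * e'" by simp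
  qed
  finally show ?thesis by (simp add: algebra_simps)
qed

text \<open>The value \<open>(N - 1) / p\<close> of \<open>L\<close> minimises the limit.\<close>
lemma second_moment_limit:
  fixes N p :: real
  assumes "N \<ge> 1" "p \<ge> 1" and "\<alpha> \<longlonglongrightarrow> 1 / p" "\<gamma> \<longlonglongrightarrow> 1 / p" and "L = (N - 1) / p"
  shows "(\<lambda>m. (N * \<alpha> m + N * (N - 1) * (\<alpha> m * \<gamma> m) - 2 * L * N * \<alpha> m + L\<^sup>2) / (N - L)\<^sup>2)
    \<longlonglongrightarrow> 1 / (N * (p - 1) + 1)"
proof -
  have pos: "N * (p - 1) + 1 > 0" using assms by (intro add_nonneg_pos mult_nonneg_nonneg) auto
  have NL: "N - L = (N * (p - 1) + 1) / p" using assms by (simp add: field_simps)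
  have "(\<lambda>m. (N * \<alpha> m + N * (N - 1) * (\<alpha> m * \<gamma> m) - 2 * L * N * \<alpha> m + L\<^sup>2) / (N - L)\<^sup>2)
    \<longlonglongrightarrow> (N * (1 / p) + N * (N - 1) * (1 / p * (1 / p)) - 2 * L * N * (1 / p) + L\<^sup>2) / (N - L)\<^sup>2"
    using assms pos NL by (intro tendsto_intros) auto
  also have "N * (1 / p) + N * (N - 1) * (1 / p * (1 / p)) - 2 * L * N * (1 / p) + L\<^sup>2
      = (N * (p - 1) + 1) / p\<^sup>2"
    using assms(2) unfolding assms(5) by (simp add: field_simps power2_eq_square)
  also have "(N * (p - 1) + 1) / p\<^sup>2 / (N - L)\<^sup>2 = 1 / (N * (p - 1) + 1)"
    unfolding NL using assms pos by (simp add: power_divide) (simp add: power2_eq_square)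
  finally show ?thesis .
qed

section \<open>The q-Pochhammer products\<close>

text \<open>
  The finite product of \<open>1 - q ^ (- i)\<close> over \<open>1 \<le> i \<le> r\<close>, that is, the \<open>q\<close>-Pochhammer symbol with
  both arguments equal to \<open>1 / q\<close>; its limit is \<open>1 / q_pi q\<close>.
\<close>
definition q_poch :: "real \<Rightarrow> nat \<Rightarrow> real" where
  "q_poch q r = (\<Prod>i<r. 1 - 1 / q ^ Suc i)"

lemma q_poch_pos: "q > 1 \<Longrightarrow> q_poch q r > 0"
  unfolding q_poch_def using one_less_power[of q "Suc _"] by (intro prod_pos) (simp add: divide_less_eq)

lemma q_poch_antimono:
  assumes "q > 1" "r \<le> s"
  shows "q_poch q s \<le> q_poch q r"
proof (rule lift_Suc_antimono_le[OF _ assms(2)])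
  fix n
  have "1 / q ^ Suc n \<ge> 0" using assms(1) by simp
  then have "q_poch q n * (1 - 1 / q ^ Suc n) \<le> q_poch q n * 1"
    using q_poch_pos[OF assms(1), of n] by (intro mult_left_mono) auto
  then show "q_poch q (Suc n) \<le> q_poch q n" by (simp add: q_poch_def)
qed

lemma q_poch_split:
  assumes "q > 1" "k \<le> N"
  shows "q_poch q N = q_poch q (N - k) * (\<Prod>i<k. 1 - 1 / q ^ (N - i))"
  using assms(2)
proof (induction k)
  case (Suc k)
  have "N - k = Suc (N - Suc k)" using Suc.prems by simp
  then have "q_poch q (N - k) = q_poch q (N - Suc k) * (1 - 1 / q ^ (N - k))"
    by (simp add: q_poch_def)
  then show ?case using Suc by simp
qed simp

lemma q_binomial_eq_q_poch:
  assumes "q > 1"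
  shows "q_binomial q (a + k) k = q ^ (a * k) * q_poch q (a + k) / (q_poch q a * q_poch q k)"
proof -
  have num: "(\<Prod>i<k. q ^ N - q ^ i) = q ^ (N * k) * (q_poch q N / q_poch q (N - k))" if "k \<le> N" for N
  proof -
    have "(\<Prod>i<k. q ^ N - q ^ i) = (\<Prod>i<k. q ^ N * (1 - 1 / q ^ (N - i)))"
    proof (rule prod.cong)
      fix i assume "i \<in> {..<k}"
      then have "q ^ N = q ^ i * q ^ (N - i)" using that by (simp flip: power_add)
      then show "q ^ N - q ^ i = q ^ N * (1 - 1 / q ^ (N - i))"
        using assms by (simp add: field_simps)
    qed simp
    also have "\<dots> = q ^ (N * k) * (\<Prod>i<k. 1 - 1 / q ^ (N - i))"
      by (simp add: prod.distrib power_mult)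
    finally show ?thesis using q_poch_split[OF assms that] q_poch_pos[OF assms, of "N - k"] by simp
  qed
  have q_poch_0: "q_poch q 0 = 1" by (simp add: q_poch_def)
  have split: "q ^ ((a + k) * k) = q ^ (a * k) * q ^ (k * k)"
    by (simp add: distrib_right power_add)
  have "q_binomial q (a + k) k
      = (q ^ ((a + k) * k) * (q_poch q (a + k) / q_poch q a)) / (q ^ (k * k) * q_poch q k)"
    unfolding q_binomial_def prod_dividef using num[of k] num[of "a + k"] by (simp add: q_poch_0)
  then show ?thesis unfolding split using assms by simp
qed

lemma q_pi_properties:
  assumes "(q::real) > 1"
  shows q_poch_tendsto: "q_poch q \<longlonglongrightarrow> 1 / q_pi q" and q_pi_ge_1: "q_pi q \<ge> 1"
proof -
  define f where "f i = q ^ Suc i / (q ^ Suc i - 1)" for i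
  have gt: "q ^ Suc i > 1" for i using assms by (intro one_less_power) auto
  have "summable (\<lambda>i. (1 / (q - 1)) * (1 / q) ^ i)"
    using assms by (intro summable_mult summable_geometric) auto
  then have "summable (\<lambda>i. norm (f i - 1))"
  proof (rule summable_comparison_test_ev[rotated], intro always_eventually allI)
    fix i
    have "f i - 1 = 1 / (q ^ Suc i - 1)" using gt[of i] by (simp add: f_def field_simps)
    also have "\<dots> \<le> 1 / ((q - 1) * q ^ i)"
    proof (rule divide_left_mono)
      have "q ^ i \<ge> 1" using assms by (intro one_le_power) simp
      then show "(q - 1) * q ^ i \<le> q ^ Suc i - 1" by (simp add: algebra_simps)
      show "0 < (q ^ Suc i - 1) * ((q - 1) * q ^ i)"
        using gt[of i] assms by (intro mult_pos_pos) auto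
    qed simp
    also have "\<dots> = (1 / (q - 1)) * (1 / q) ^ i" by (simp add: power_divide)
    finally show "norm (norm (f i - 1)) \<le> (1 / (q - 1)) * (1 / q) ^ i"
      using gt[of i] by (simp add: f_def)
  qed
  then have "abs_convergent_prod f" by (simp add: abs_convergent_prod_conv_summable)
  then have "convergent_prod f" by (rule abs_convergent_prod_imp_convergent_prod)
  then have "(\<lambda>n. \<Prod>i\<le>n. f i) \<longlonglongrightarrow> prodinf f" by (rule convergent_prod_LIMSEQ)
  then have lim: "(\<lambda>n. \<Prod>i\<le>n. f i) \<longlonglongrightarrow> q_pi q" by (simp add: q_pi_def f_def[abs_def])
  have f1: "f i \<ge> 1" for i using gt[of i] by (simp add: f_def)
  show ge: "q_pi q \<ge> 1"
    using lim f1 by (intro LIMSEQ_le_const[OF lim]) (auto intro: prod_ge_1)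
  have "q_poch q (Suc n) = 1 / (\<Prod>i\<le>n. f i)" for n
  proof -
    have "q_poch q (Suc n) * (\<Prod>i\<le>n. f i) = (\<Prod>i\<le>n. (1 - 1 / q ^ Suc i) * f i)"
      by (simp only: q_poch_def lessThan_Suc_atMost prod.distrib)
    also have "\<dots> = 1"
    proof (rule prod.neutral, rule ballI)
      fix i show "(1 - 1 / q ^ Suc i) * f i = 1"
        using gt[of i] assms by (simp add: f_def divide_simps)
    qed
    finally have *: "q_poch q (Suc n) * (\<Prod>i\<le>n. f i) = 1" .
    have "(\<Prod>i\<le>n. f i) \<ge> 1" using f1 by (intro prod_ge_1) auto
    then have "(\<Prod>i\<le>n. f i) \<noteq> 0" by linarith
    then show ?thesis using * nonzero_eq_divide_eq by blast
  qed
  then have "(\<lambda>n. q_poch q (Suc n)) \<longlonglongrightarrow> 1 / q_pi q"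
    using tendsto_divide[OF tendsto_const lim] ge by simp
  then show "q_poch q \<longlonglongrightarrow> 1 / q_pi q" by (simp only: filterlim_sequentially_Suc)
qed

section \<open>Counting subspaces and complements over a finite field\<close>

text \<open>
  Vector spaces over a finite field; \<open>q\<close> stands for \<open>CARD('a)\<close> below. The whole space may be infinite,
  but the subspaces that are counted are finite.
\<close>
locale finite_field_space = vector_space scale
  for scale :: "'a::{field,finite} \<Rightarrow> 'b::ab_group_add \<Rightarrow> 'b" (infixr "*s" 75)
begin

lemma card_field_gt_1: "CARD('a) > 1"
proof -
  have "card {0, 1 :: 'a} \<le> CARD('a)" by (rule card_mono) auto
  then show ?thesis by simp
qed

lemma span_of_subspace: "subspace U \<Longrightarrow> span U = U"
  by (simp add: span_eq_iff)

lemma span_insert_subspace: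
  assumes "subspace U"
  shows "span (insert x U) = {u + c *s x | u c. u \<in> U}"
proof -
  have "x' - c *s x \<in> U \<longleftrightarrow> (\<exists>u\<in>U. x' = u + c *s x)" for x' c
  proof
    assume "x' - c *s x \<in> U"
    then show "\<exists>u\<in>U. x' = u + c *s x" by (intro bexI[of _ "x' - c *s x"]) auto
  qed auto
  then show ?thesis
    unfolding span_insert span_of_subspace[OF assms] by blast
qed

lemma subspace_card_pos: "subspace U \<Longrightarrow> finite U \<Longrightarrow> card U > 0"
  using subspace_0 card_gt_0_iff by blast

lemma finite_span_insert: "subspace U \<Longrightarrow> finite U \<Longrightarrow> finite (span (insert x U))"
proof -
  assume U: "subspace U" "finite U"
  have "span (insert x U) = (\<lambda>(u, c). u + c *s x) ` (U \<times> UNIV)"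
    using span_insert_subspace[OF U(1)] by auto
  then show ?thesis using U(2) by simp
qed

lemma card_span_insert:
  assumes U: "subspace U" "finite U" and x: "x \<notin> U"
  shows "card (span (insert x U)) = CARD('a) * card U"
proof -
  have eq: "span (insert x U) = (\<lambda>(u, c). u + c *s x) ` (U \<times> UNIV)"
    using span_insert_subspace[OF U(1)] by auto
  have "inj_on (\<lambda>(u, c). u + c *s x) (U \<times> UNIV)"
  proof (rule inj_onI, clarsimp)
    fix u c u' c' assume u: "u \<in> U" "u' \<in> U" and e: "u + c *s x = u' + c' *s x"
    have "c = c'"
    proof (rule ccontr)
      assume "c \<noteq> c'"
      have "(c - c') *s x = u' - u" using e by (simp add: algebra_simps)
      then have "(c - c') *s x \<in> U" using u U(1) subspace_diff by metis
      then have "inverse (c - c') *s (c - c') *s x \<in> U" using U(1) subspace_scale by blast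
      then show False using \<open>c \<noteq> c'\<close> x by simp
    qed
    then show "u = u' \<and> c = c'" using e by simp
  qed
  then show ?thesis unfolding eq by (simp add: card_image card_cartesian_product)
qed

text \<open>
  The list is linearly independent modulo the subspace \<open>U\<close>. Recursion along a growing subspace,
  instead of linear combinations, makes the greedy count of such lists an induction.
\<close>
primrec indep_over :: "'b set \<Rightarrow> 'b list \<Rightarrow> bool" where
  "indep_over U [] \<longleftrightarrow> True"
| "indep_over U (x # xs) \<longleftrightarrow> x \<notin> U \<and> indep_over (span (insert x U)) xs"

text \<open>Lists of \<open>k\<close> vectors of \<open>W\<close> that are linearly independent modulo \<open>U\<close>.\<close>
definition frames :: "nat \<Rightarrow> 'b set \<Rightarrow> 'b set \<Rightarrow> 'b list set" where
  "frames k W U = {xs. length xs = k \<and> set xs \<subseteq> W \<and> indep_over U xs}"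

lemma finite_frames: "finite W \<Longrightarrow> finite (frames k W U)"
  unfolding frames_def
  by (rule finite_subset[OF _ finite_lists_length_eq[of W k]]) auto

lemma frames_Suc:
  "frames (Suc k) W U = (\<lambda>(x, xs). x # xs) ` (SIGMA x:W - U. frames k W (span (insert x U)))"
proof (rule Set.set_eqI, rule iffI)
  fix ys assume "ys \<in> frames (Suc k) W U"
  then show "ys \<in> (\<lambda>(x, xs). x # xs) ` (SIGMA x:W - U. frames k W (span (insert x U)))"
    by (cases ys) (auto simp: frames_def image_iff)
qed (auto simp: frames_def)

text \<open>
  The greedy count: after \<open>i\<close> vectors have been chosen, the next one must avoid a subspace of
  \<open>q ^ i * card U\<close> elements. If \<open>k\<close> exceeds the codimension of \<open>U\<close>, then one factor vanishes, so
  no bound on \<open>k\<close> is needed.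
\<close>
lemma card_frames:
  assumes "subspace W" "finite W" "subspace U" "U \<subseteq> W"
  shows "real (card (frames k W U)) = (\<Prod>i<k. real (card W) - real CARD('a) ^ i * real (card U))"
  using assms(3,4)
proof (induction k arbitrary: U)
  case 0
  have "frames 0 W U = {[]}" by (auto simp: frames_def)
  then show ?case by simp
next
  case (Suc k)
  have fU: "finite U" using Suc.prems assms finite_subset by blast
  have IH: "real (card (frames k W (span (insert x U))))
      = (\<Prod>i<k. real (card W) - real CARD('a) ^ Suc i * real (card U))" if "x \<in> W - U" for x
  proof -
    have "span (insert x U) \<subseteq> W"
      using that Suc.prems assms(1) by (intro span_minimal) auto
    then have "real (card (frames k W (span (insert x U))))
      = (\<Prod>i<k. real (card W) - real CARD('a) ^ i * real (card (span (insert x U))))"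
      by (intro Suc.IH) auto
    then show ?thesis using card_span_insert[of U x] that Suc.prems fU by (simp add: mult_ac)
  qed
  have "card (frames (Suc k) W U) = card (SIGMA x:W - U. frames k W (span (insert x U)))"
    unfolding frames_Suc by (intro card_image inj_onI) auto
  also have "\<dots> = (\<Sum>x\<in>W - U. card (frames k W (span (insert x U))))"
    using assms by (intro card_SigmaI) (auto intro: finite_frames)
  finally have "real (card (frames (Suc k) W U))
    = (\<Sum>x\<in>W - U. \<Prod>i<k. real (card W) - real CARD('a) ^ Suc i * real (card U))"
    using IH by simp
  also have "\<dots> = (real (card W) - real (card U)) *
      (\<Prod>i<k. real (card W) - real CARD('a) ^ Suc i * real (card U))"
    using Suc.prems fU assms by (simp add: card_Diff_subset card_mono of_nat_diff)
  also have "\<dots> = (\<Prod>i<Suc k. real (card W) - real CARD('a) ^ i * real (card U))"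
    by (subst prod.lessThan_Suc_shift) simp
  finally show ?case .
qed

lemma span_insert_Un: "span (span (insert x U) \<union> S) = span (U \<union> insert x S)"
proof (rule antisym)
  show "span (span (insert x U) \<union> S) \<subseteq> span (U \<union> insert x S)"
  proof (rule span_minimal)
    have "span (insert x U) \<subseteq> span (U \<union> insert x S)" by (rule span_mono) auto
    then show "span (insert x U) \<union> S \<subseteq> span (U \<union> insert x S)"
      by (auto intro: span_base)
  qed simp
  show "span (U \<union> insert x S) \<subseteq> span (span (insert x U) \<union> S)"
    by (rule span_mono) (auto intro: span_base)
qed

lemma indep_over_append:
  assumes "subspace U"
  shows "indep_over U (xs @ ys) \<longleftrightarrow> indep_over U xs \<and> indep_over (span (U \<union> set xs)) ys"
  using assms
proof (induction xs arbitrary: U)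
  case Nil
  then show ?case by (simp add: span_of_subspace)
next
  case (Cons x xs)
  then show ?case using Cons.IH[of "span (insert x U)"] by (auto simp: span_insert_Un)
qed

lemma card_span_indep:
  assumes "subspace U" "finite U" "indep_over U xs"
  shows "finite (span (U \<union> set xs)) \<and> card (span (U \<union> set xs)) = CARD('a) ^ length xs * card U"
  using assms
proof (induction xs arbitrary: U)
  case Nil
  then show ?case by (simp add: span_of_subspace)
next
  case (Cons x xs)
  have "finite (span (span (insert x U) \<union> set xs)) \<and>
    card (span (span (insert x U) \<union> set xs)) = CARD('a) ^ length xs * card (span (insert x U))"
    using Cons.prems by (intro Cons.IH) (auto simp: finite_span_insert)
  then show ?case using card_span_insert[of U x] Cons.prems
    by (simp add: span_insert_Un)
qed

lemma card_span_indep_0: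
  assumes "indep_over {0} xs"
  shows "finite (span (set xs))" "card (span (set xs)) = CARD('a) ^ length xs"
  using card_span_indep[OF _ _ assms] by (auto simp: span_insert_0 subspace_def)

text \<open>
  Independence modulo a larger subspace \<open>A\<close> splits into independence modulo \<open>U\<close> and the condition
  that the span meets \<open>A\<close> only in \<open>U\<close>. With \<open>U = {0}\<close> this turns the condition \<open>C \<inter> A = {0}\<close> on a
  subspace into a condition on its bases that the greedy count can handle.
\<close>
lemma indep_over_iff:
  assumes "subspace U" "subspace A" "U \<subseteq> A"
  shows "indep_over A xs \<longleftrightarrow> indep_over U xs \<and> span (U \<union> set xs) \<inter> A \<subseteq> U"
  using assms
proof (induction xs arbitrary: U A)
  case Nil
  then show ?case by (auto simp: span_of_subspace)
next
  case (Cons x xs)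
  let ?U = "span (insert x U)" and ?A = "span (insert x A)" and ?S = "span (U \<union> insert x (set xs))"
  have "?U \<subseteq> ?A" using Cons.prems by (intro span_mono) auto
  then have IH: "indep_over ?A xs \<longleftrightarrow> indep_over ?U xs \<and> ?S \<inter> ?A \<subseteq> ?U"
    using Cons.IH[of ?U ?A] by (simp add: span_insert_Un)
  have Uel: "?U = {u + c *s x | u c. u \<in> U}" and Ael: "?A = {u + c *s x | u c. u \<in> A}"
    using Cons.prems span_insert_subspace by auto
  have xS: "x \<in> ?S" by (auto intro: span_base)
  show ?case
  proof
    assume L: "indep_over A (x # xs)"
    then have x: "x \<notin> A" and "?S \<inter> ?A \<subseteq> ?U" and i: "indep_over ?U xs" using IH by auto
    have "?S \<inter> A \<subseteq> U"
    proof
      fix v assume v: "v \<in> ?S \<inter> A"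
      then have "v \<in> ?A" by (auto intro: span_base)
      then have "v \<in> ?U" using v \<open>?S \<inter> ?A \<subseteq> ?U\<close> by blast
      then obtain u c where uc: "v = u + c *s x" "u \<in> U" using Uel by auto
      have "c = 0"
      proof (rule ccontr)
        assume c: "c \<noteq> 0"
        have "c *s x = v - u" using uc by simp
        then have "c *s x \<in> A" using v uc Cons.prems subspace_diff[of A v u] by auto
        then have "inverse c *s c *s x \<in> A" using Cons.prems subspace_scale by blast
        then show False using c x by simp
      qed
      then show "v \<in> U" using uc by simp
    qed
    then show "indep_over U (x # xs) \<and> span (U \<union> set (x # xs)) \<inter> A \<subseteq> U"
      using i x Cons.prems by auto
  next
    assume R: "indep_over U (x # xs) \<and> span (U \<union> set (x # xs)) \<inter> A \<subseteq> U"
    then have SA: "?S \<inter> A \<subseteq> U" and xU: "x \<notin> U" by auto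
    have "x \<notin> A" using SA xU xS by auto
    moreover have "?S \<inter> ?A \<subseteq> ?U"
    proof
      fix v assume v: "v \<in> ?S \<inter> ?A"
      then obtain a c where ac: "v = a + c *s x" "a \<in> A" using Ael by auto
      have "a = v - c *s x" using ac by simp
      then have "a \<in> ?S" using v xS span_diff span_scale by auto
      then show "v \<in> ?U" using SA ac Uel by auto
    qed
    ultimately show "indep_over A (x # xs)" using IH R by auto
  qed
qed

corollary indep_over_iff_trivial_Int:
  assumes "subspace A"
  shows "indep_over A xs \<longleftrightarrow> indep_over {0} xs \<and> span (set xs) \<inter> A = {0}"
  using indep_over_iff[of "{0}" A xs] assms subspace_0[OF assms] subspace_0[OF subspace_span[of "set xs"]]
  by (auto simp: span_insert_0 subspace_single_0)

lemma frames_nonempty: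
  assumes "subspace W" "finite W" "subspace U" "U \<subseteq> W" "card W = CARD('a) ^ k * card U"
  shows "\<exists>xs. length xs = k \<and> set xs \<subseteq> W \<and> indep_over U xs"
proof -
  have fU: "card U > 0" using assms subspace_card_pos finite_subset by metis
  have "(\<Prod>i<k. real (card W) - real CARD('a) ^ i * real (card U)) > 0"
    using fU card_field_gt_1 assms(5) by (intro prod_pos) (auto simp: power_strict_increasing)
  then have "card (frames k W U) > 0" using card_frames[OF assms(1-4), of k] by linarith
  then show ?thesis by (auto simp: frames_def card_gt_0_iff)
qed

lemma subspace_tower:
  assumes "subspace W" "finite W" "subspace U" "U \<subseteq> W"
  shows "\<exists>k. card W = CARD('a) ^ k * card U"
  using assms(3,4)
proof (induction "card (W - U)" arbitrary: U rule: less_induct)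
  case less
  show ?case
  proof (cases "U = W")
    case True
    then show ?thesis by (intro exI[of _ 0]) simp
  next
    case False
    then obtain x where x: "x \<in> W" "x \<notin> U" using less.prems by auto
    have sub: "span (insert x U) \<subseteq> W"
      using x less.prems assms by (intro span_minimal) auto
    have "W - span (insert x U) \<subset> W - U"
      using x by (auto intro: span_base)
    then have "card (W - span (insert x U)) < card (W - U)"
      using assms by (intro psubset_card_mono) auto
    then obtain k where "card W = CARD('a) ^ k * card (span (insert x U))"
      using less.hyps sub by blast
    then have "card W = CARD('a) ^ Suc k * card U"
      using card_span_insert[of U x] x less.prems assms finite_subset by (auto simp: mult_ac)
    then show ?thesis by blast
  qed
qed

text \<open>
  The \<open>k\<close>-dimensional subspaces of \<open>W\<close>. Over a finite field the dimension can be read off from the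
  number of elements, and \<open>W\<close> is finite in all applications.
\<close>
definition subspaces :: "nat \<Rightarrow> 'b set \<Rightarrow> 'b set set" where
  "subspaces k W = {C. subspace C \<and> C \<subseteq> W \<and> card C = CARD('a) ^ k}"

lemma finite_subspaces: "finite W \<Longrightarrow> finite (subspaces k W)"
  by (rule finite_subset[of _ "Pow W"]) (auto simp: subspaces_def)

lemma subspacesD:
  assumes "C \<in> subspaces k W" "finite W"
  shows "subspace C" "C \<subseteq> W" "card C = CARD('a) ^ k" "finite C"
  using assms by (auto simp: subspaces_def finite_subset)

text \<open>Double counting of pairs of a subspace and an ordered basis of it.\<close>
lemma card_subspaces_frames:
  assumes W: "subspace W" "finite W"
  shows "real (card {C \<in> subspaces k W. P C}) * (\<Prod>i<k. real CARD('a) ^ k - real CARD('a) ^ i)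
    = real (card {xs \<in> frames k W {0}. P (span (set xs))})"
proof -
  let ?D = "{C \<in> subspaces k W. P C}" and ?F = "{xs \<in> frames k W {0}. P (span (set xs))}"
  have s0: "subspace {0}" by (simp add: subspace_def)
  have eq: "?F = (\<Union>C\<in>?D. frames k C {0})"
  proof (rule Set.set_eqI, rule iffI)
    fix xs assume xs: "xs \<in> ?F"
    then have i: "indep_over {0} xs" and l: "length xs = k" and sub: "set xs \<subseteq> W"
      by (auto simp: frames_def)
    have "span (set xs) \<in> ?D"
      using card_span_indep_0[OF i] xs l sub W span_minimal[of "set xs" W]
      by (auto simp: subspaces_def)
    moreover have "xs \<in> frames k (span (set xs)) {0}"
      using i l by (auto simp: frames_def intro: span_base)
    ultimately show "xs \<in> (\<Union>C\<in>?D. frames k C {0})" by blast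
  next
    fix xs assume "xs \<in> (\<Union>C\<in>?D. frames k C {0})"
    then obtain C where C: "C \<in> subspaces k W" "P C" and xs: "xs \<in> frames k C {0}" by auto
    have i: "indep_over {0} xs" "length xs = k" "set xs \<subseteq> C" using xs by (auto simp: frames_def)
    have "span (set xs) = C"
      using card_span_indep_0[OF i(1)] i subspacesD[OF C(1) W(2)] span_minimal[of "set xs" C]
      by (intro card_subset_eq) auto
    then show "xs \<in> ?F" using C i subspacesD[OF C(1) W(2)] by (auto simp: frames_def)
  qed
  have spanC: "span (set xs) = C" if "C \<in> ?D" "xs \<in> frames k C {0}" for C xs
  proof -
    have i: "indep_over {0} xs" "length xs = k" "set xs \<subseteq> C" using that by (auto simp: frames_def)
    have C: "C \<in> subspaces k W" using that by auto
    show ?thesis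
      using card_span_indep_0[OF i(1)] i subspacesD[OF C W(2)] span_minimal[of "set xs" C]
      by (intro card_subset_eq) auto
  qed
  have "card ?F = (\<Sum>C\<in>?D. card (frames k C {0}))"
    unfolding eq
  proof (rule card_UN_disjoint)
    show "finite ?D" using finite_subspaces[OF W(2)] by auto
    show "\<forall>C\<in>?D. finite (frames k C {0})"
    proof
      fix C assume "C \<in> ?D"
      then have "C \<in> subspaces k W" by simp
      then show "finite (frames k C {0})" by (intro finite_frames subspacesD(4)[OF _ W(2)])
    qed
    show "\<forall>C\<in>?D. \<forall>C'\<in>?D. C \<noteq> C' \<longrightarrow> frames k C {0} \<inter> frames k C' {0} = {}"
    proof (intro ballI impI)
      fix C C' assume C: "C \<in> ?D" "C' \<in> ?D" "C \<noteq> C'"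
      show "frames k C {0} \<inter> frames k C' {0} = {}"
        using spanC[OF C(1)] spanC[OF C(2)] C(3) by (metis disjoint_iff)
    qed
  qed
  then have "real (card ?F) = (\<Sum>C\<in>?D. real (card (frames k C {0})))" by simp
  also have "\<dots> = (\<Sum>C\<in>?D. \<Prod>i<k. real CARD('a) ^ k - real CARD('a) ^ i)"
  proof (rule sum.cong)
    fix C assume "C \<in> ?D"
    then have C: "C \<in> subspaces k W" by auto
    have "real (card (frames k C {0})) = (\<Prod>i<k. real (card C) - real CARD('a) ^ i * real (card {0::'b}))"
      using subspacesD[OF C W(2)] subspace_0 s0 by (intro card_frames) auto
    then show "real (card (frames k C {0})) = (\<Prod>i<k. real CARD('a) ^ k - real CARD('a) ^ i)"
      using subspacesD[OF C W(2)] by simp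
  qed simp
  finally show ?thesis by simp
qed

lemma frame_count_pos: "(\<Prod>i<k. real CARD('a) ^ k - real CARD('a) ^ i) > 0"
  using card_field_gt_1 by (intro prod_pos) (auto simp: power_strict_increasing)

lemma card_subspaces:
  assumes W: "subspace W" "finite W" "card W = CARD('a) ^ w"
  shows "real (card (subspaces k W)) = q_binomial (real CARD('a)) w k"
proof -
  have "real (card {C \<in> subspaces k W. True}) * (\<Prod>i<k. real CARD('a) ^ k - real CARD('a) ^ i)
    = real (card {xs \<in> frames k W {0}. True})"
    by (rule card_subspaces_frames[OF W(1,2)])
  also have "\<dots> = (\<Prod>i<k. real CARD('a) ^ w - real CARD('a) ^ i)"
    using card_frames[OF W(1,2), of "{0}" k] W subspace_0 by (auto simp: subspace_def)
  finally have "real (card (subspaces k W)) * (\<Prod>i<k. real CARD('a) ^ k - real CARD('a) ^ i)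
    = (\<Prod>i<k. real CARD('a) ^ w - real CARD('a) ^ i)" by simp
  then show ?thesis
    using less_imp_neq[OF frame_count_pos[of k], symmetric]
    unfolding q_binomial_def prod_dividef by (subst nonzero_eq_divide_eq) simp_all
qed

lemma card_complements:
  assumes W: "subspace W" "finite W" "card W = CARD('a) ^ (a + k)"
    and A: "subspace A" "A \<subseteq> W" "card A = CARD('a) ^ a"
  shows "real (card {C \<in> subspaces k W. C \<inter> A = {0}}) = real CARD('a) ^ (a * k)"
proof -
  have "real (card {C \<in> subspaces k W. C \<inter> A = {0}}) * (\<Prod>i<k. real CARD('a) ^ k - real CARD('a) ^ i)
    = real (card {xs \<in> frames k W {0}. span (set xs) \<inter> A = {0}})"
    by (rule card_subspaces_frames[OF W(1,2)])
  also have "{xs \<in> frames k W {0}. span (set xs) \<inter> A = {0}} = frames k W A"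
    using indep_over_iff_trivial_Int[OF A(1)] by (auto simp: frames_def)
  also have "real (card (frames k W A)) = (\<Prod>i<k. real (card W) - real CARD('a) ^ i * real (card A))"
    by (rule card_frames[OF W(1,2) A(1,2)])
  also have "\<dots> = (\<Prod>i<k. real CARD('a) ^ a * (real CARD('a) ^ k - real CARD('a) ^ i))"
    by (simp add: W A algebra_simps power_add)
  also have "\<dots> = real CARD('a) ^ (a * k) * (\<Prod>i<k. real CARD('a) ^ k - real CARD('a) ^ i)"
    by (simp add: prod.distrib power_mult)
  finally show ?thesis
    using mult_right_cancel[OF less_imp_neq[OF frame_count_pos[of k], symmetric]] by blast
qed

lemma span_insert_translate:
  assumes "subspace U" "z - y \<in> U"
  shows "span (insert z U) = span (insert y U)"
proof (rule antisym; rule span_minimal)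
  have "y + (z - y) \<in> span (insert y U)"
    using assms(2) by (intro span_add) (auto intro: span_base)
  then show "insert z U \<subseteq> span (insert y U)" by (auto intro: span_base)
  have "z - (z - y) \<in> span (insert z U)"
    using assms(2) by (intro span_diff[of z _ "z - y"]) (auto intro: span_base)
  then have "y \<in> span (insert z U)" by simp
  then show "insert y U \<subseteq> span (insert z U)" by (auto intro: span_base)
qed auto

lemma indep_over_translate:
  assumes "list_all2 (\<lambda>y z. z - y \<in> U) ys zs" "subspace U"
  shows "indep_over U ys \<longleftrightarrow> indep_over U zs"
proof -
  have "indep_over V ys \<longleftrightarrow> indep_over V zs" if "U \<subseteq> V" "subspace V" for V
    using assms(1) that
  proof (induction arbitrary: V rule: list_all2_induct)
    case Nil
    then show ?case by simp
  next
    case (Cons y ys z zs)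
    have zy: "z - y \<in> V" using Cons by auto
    have "y \<in> V \<longleftrightarrow> z \<in> V"
      using subspace_add[OF \<open>subspace V\<close> zy, of y] subspace_diff[OF \<open>subspace V\<close> _ zy, of z]
      by auto
    moreover have "indep_over (span (insert y V)) ys \<longleftrightarrow> indep_over (span (insert y V)) zs"
    proof (rule Cons.IH)
      show "U \<subseteq> span (insert y V)" using Cons.prems by (auto intro: span_base)
    qed simp
    ultimately show ?case
      using span_insert_translate[OF \<open>subspace V\<close> zy] by simp
  qed
  then show ?thesis using assms(2) by auto
qed

text \<open>
  If \<open>t \<in> T\<close>, then some \<open>u \<in> U\<close> satisfies \<open>u + t \<in> C\<close>; together with \<open>y + t \<in> C\<close> this puts \<open>y - u\<close>
  into \<open>C \<inter> B = {0}\<close>, so \<open>y \<in> U\<close>. Hence independence of the \<open>y\<close>'s modulo \<open>U\<close> carries over to the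
  \<open>t\<close>'s modulo \<open>T\<close>. The last premise survives the adjunction of \<open>y\<close> to \<open>U\<close> and \<open>t\<close> to \<open>T\<close>; for
  \<open>T = U\<close> it holds with \<open>u = - t\<close>.
\<close>
lemma indep_over_shift_into_complement:
  assumes "list_all2 (\<lambda>y t. y + t \<in> C) ys ts"
    and "indep_over U ys" "set ys \<subseteq> B" "U \<subseteq> B"
    and "subspace U" "subspace T" "subspace B" "subspace C" "C \<inter> B = {0}"
    and "\<And>t. t \<in> T \<Longrightarrow> \<exists>u\<in>U. u + t \<in> C"
  shows "indep_over T ts"
  using assms
proof (induction arbitrary: U T rule: list_all2_induct)
  case Nil
  show ?case by simp
next
  case (Cons y ys t ts)
  note T = \<open>\<And>t. t \<in> T \<Longrightarrow> \<exists>u\<in>U. u + t \<in> C\<close>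
  have yt: "y + t \<in> C" using Cons.hyps by simp
  have "t \<notin> T"
  proof
    assume "t \<in> T"
    then obtain u where u: "u \<in> U" "u + t \<in> C" using T by meson
    have "(y + t) - (u + t) \<in> C" using subspace_diff[OF \<open>subspace C\<close> yt u(2)] .
    moreover have "y - u \<in> B" using u Cons.prems by (intro subspace_diff) auto
    ultimately have "y - u \<in> C \<inter> B" by simp
    then have "y = u" using \<open>C \<inter> B = {0}\<close> by auto
    then show False using u Cons.prems(1) by simp
  qed
  moreover have "indep_over (span (insert t T)) ts"
  proof (rule Cons.IH)
    show "indep_over (span (insert y U)) ys" "set ys \<subseteq> B" using Cons.prems(1,2) by auto
    show "span (insert y U) \<subseteq> B" using Cons.prems(2,3,6) by (intro span_minimal) auto
    fix v assume "v \<in> span (insert t T)"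
    then obtain s c where v: "v = s + c *s t" "s \<in> T"
      using span_insert_subspace[OF \<open>subspace T\<close>, of t] by auto
    obtain u where u: "u \<in> U" "u + s \<in> C" using T[OF v(2)] by meson
    have "(u + s) + c *s (y + t) \<in> C"
      using subspace_add[OF \<open>subspace C\<close> u(2) subspace_scale[OF \<open>subspace C\<close> yt]] .
    then have "(u + c *s y) + v \<in> C" using v by (simp add: algebra_simps)
    moreover have "u + c *s y \<in> span (insert y U)"
      using u by (intro span_add span_scale) (auto intro: span_base)
    ultimately show "\<exists>u\<in>span (insert y U). u + v \<in> C" by blast
  qed (use Cons.prems(6-8) in simp_all)
  ultimately show ?case by simp
qed

text \<open>A complement \<open>C\<close> of \<open>A\<close> satisfies \<open>A + C = W\<close>.\<close>
lemma complement_sum: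
  assumes W: "subspace W" "finite W" "card W = CARD('a) ^ (a + k)"
    and A: "subspace A" "A \<subseteq> W" "card A = CARD('a) ^ a"
    and C: "C \<in> subspaces k W" "C \<inter> A = {0}"
    and y: "y \<in> W"
  shows "\<exists>t\<in>A. y + t \<in> C"
proof -
  note C' = subspacesD[OF C(1) W(2)]
  have fA: "finite A" using A W finite_subset by blast
  have "\<exists>xs. length xs = k \<and> set xs \<subseteq> C \<and> indep_over {0} xs"
    using C' subspace_0 by (intro frames_nonempty) auto
  then obtain xs where xs: "length xs = k" "set xs \<subseteq> C" "indep_over {0} xs" by blast
  have "span (set xs) \<subseteq> C" using xs C' by (intro span_minimal) auto
  then have "span (set xs) \<inter> A = {0}"
    using C(2) subspace_0[OF A(1)] subspace_0[OF subspace_span[of "set xs"]] by auto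
  then have i: "indep_over A xs" using indep_over_iff_trivial_Int[OF A(1)] xs by simp
  have "span (A \<union> set xs) \<subseteq> W" using A W xs C' by (intro span_minimal) auto
  then have "span (A \<union> set xs) = W"
    using card_span_indep[OF A(1) fA i] W A xs
    by (intro card_subset_eq) (auto simp: power_add)
  then have "y \<in> span (A \<union> set xs)" using y by simp
  then obtain s c where "y = s + c" "s \<in> span A" "c \<in> span (set xs)"
    unfolding span_Un by blast
  then have "y + (- s) \<in> C" "- s \<in> A"
    using \<open>span (set xs) \<subseteq> C\<close> A span_of_subspace subspace_neg by auto
  then show ?thesis by blast
qed

text \<open>
  Fix vectors \<open>y\<^sub>1, \<dots>, y\<^sub>k\<close> that form a basis of \<open>W\<close> modulo \<open>A\<close>, the first \<open>r\<close> of them lying in \<open>B\<close>.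
  A complement \<open>C\<close> of \<open>A\<close> is determined by the unique \<open>t\<^sub>1, \<dots>, t\<^sub>k \<in> A\<close> with \<open>y\<^sub>i + t\<^sub>i \<in> C\<close>.
  If \<open>C\<close> also meets \<open>B\<close> trivially, then \<open>t\<^sub>1, \<dots>, t\<^sub>r\<close> are independent modulo \<open>A \<inter> B\<close>, which holds for a
  fraction \<open>q_poch q r\<close> of all tuples.
\<close>
lemma card_common_complements_le:
  assumes W: "subspace W" "finite W" "card W = CARD('a) ^ (a + k)"
    and A: "subspace A" "A \<subseteq> W" "card A = CARD('a) ^ a"
    and B: "subspace B" "B \<subseteq> W" "card B = CARD('a) ^ a"
    and r: "CARD('a) ^ a = CARD('a) ^ r * card (A \<inter> B)"
  shows "real (card {C \<in> subspaces k W. C \<inter> A = {0} \<and> C \<inter> B = {0}})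
    \<le> real CARD('a) ^ (a * k) * q_poch (real CARD('a)) r"
proof -
  let ?q = "real CARD('a)"
  let ?S = "{C \<in> subspaces k W. C \<inter> A = {0} \<and> C \<inter> B = {0}}"
  have q1: "?q > 1" using card_field_gt_1 by simp
  have fin: "finite A" "finite B" using A B W finite_subset by blast+
  have AB: "subspace (A \<inter> B)" using A B subspace_inter by blast
  \<comment> \<open>A basis of \<open>B\<close> modulo \<open>A \<inter> B\<close>, which is then extended to a basis of \<open>W\<close> modulo \<open>A\<close>.\<close>
  obtain ys1 where y1: "length ys1 = r" "set ys1 \<subseteq> B" "indep_over (A \<inter> B) ys1"
    using frames_nonempty[of B "A \<inter> B" r] AB B fin r by auto
  have "span (A \<inter> B \<union> set ys1) \<subseteq> B" using y1 B by (intro span_minimal) auto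
  then have i1: "indep_over A ys1"
    using indep_over_iff[OF AB A(1)] y1 by blast
  define E where "E = span (A \<union> set ys1)"
  have E: "card E = CARD('a) ^ (r + a)" "finite E"
    using card_span_indep[OF A(1) fin(1) i1] A y1 by (auto simp: E_def power_add)
  have EW: "E \<subseteq> W" unfolding E_def using A B W y1 by (intro span_minimal) auto
  have "card E \<le> card W" using EW W by (intro card_mono) auto
  then have rk: "r \<le> k" using E W q1 by simp
  have "CARD('a) ^ (a + k) = CARD('a) ^ (k - r) * card E"
    using rk E by (simp flip: power_add add: add.commute)
  then obtain ys2 where y2: "length ys2 = k - r" "set ys2 \<subseteq> W" "indep_over E ys2"
    using frames_nonempty[of W E "k - r"] W EW by (auto simp: E_def)
  define ys where "ys = ys1 @ ys2"
  have ys: "length ys = k" "set ys \<subseteq> W" "indep_over A ys"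
    using y1 y2 rk B i1 indep_over_append[OF A(1)] by (auto simp: ys_def E_def)
  define t where "t C y = (SOME t. t \<in> A \<and> y + t \<in> C)" for C y
  have t: "t C y \<in> A" "y + t C y \<in> C" if "C \<in> ?S" "y \<in> W" for C y
    using someI_ex[of "\<lambda>t. t \<in> A \<and> y + t \<in> C"] complement_sum[OF W A _ _ that(2), of C] that(1)
    unfolding t_def by blast+
  define f where "f C = (map (t C) ys1, map (t C) ys2)" for C
  define T where "T = frames r A (A \<inter> B) \<times> {ts. set ts \<subseteq> A \<and> length ts = k - r}"
  have finT: "finite T"
    unfolding T_def using fin finite_frames finite_lists_length_eq by blast
  have "f ` ?S \<subseteq> T"
  proof (rule image_subsetI)
    fix C assume C: "C \<in> ?S"
    have sC: "subspace C" using C by (auto simp: subspaces_def)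
    have "indep_over (A \<inter> B) (map (t C) ys1)"
    proof (rule indep_over_shift_into_complement[where B = B and C = C and U = "A \<inter> B" and ys = ys1])
      show "list_all2 (\<lambda>y s. y + s \<in> C) ys1 (map (t C) ys1)"
        using t[OF C] y1 B by (auto simp: list_all2_conv_all_nth subset_iff)
      show "\<exists>u\<in>A \<inter> B. u + s \<in> C" if "s \<in> A \<inter> B" for s
        using that subspace_neg[OF AB that] subspace_0[OF sC]
        by (intro bexI[of _ "- s"]) auto
    qed (use y1 A B AB sC C in auto)
    then show "f C \<in> T"
      using t[OF C] y1 y2 B by (auto simp: f_def T_def frames_def)
  qed
  moreover have "inj_on f ?S"
  proof (rule inj_onI)
    fix C D assume C: "C \<in> ?S" and D: "D \<in> ?S" and "f C = f D"
    then have eq: "t C y = t D y" if "y \<in> set ys" for y using that by (auto simp: f_def ys_def)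
    \<comment> \<open>The vectors \<open>y + t\<close> form a basis of both \<open>C\<close> and \<open>D\<close>.\<close>
    define zs where "zs = map (\<lambda>y. y + t C y) ys"
    have "list_all2 (\<lambda>y z. z - y \<in> A) ys zs"
      using t[OF C] ys by (auto simp: zs_def list_all2_conv_all_nth subset_iff)
    then have "indep_over A zs" using indep_over_translate A ys by blast
    then have "indep_over {0} zs" using indep_over_iff_trivial_Int[OF A(1)] by blast
    then have zs: "finite (span (set zs))" "card (span (set zs)) = CARD('a) ^ k"
      using card_span_indep_0[of zs] ys by (auto simp: zs_def)
    have span_zs: "span (set zs) = C'" if C': "C' \<in> ?S" "set zs \<subseteq> C'" for C'
    proof (rule card_subset_eq)
      have *: "C' \<in> subspaces k W" using C' by blast
      show "finite C'" "card (span (set zs)) = card C'" using zs subspacesD[OF * W(2)] by auto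
      show "span (set zs) \<subseteq> C'" using C' subspacesD[OF * W(2)] by (intro span_minimal) auto
    qed
    have "set zs \<subseteq> C" using t[OF C] ys by (auto simp: zs_def)
    moreover have "set zs \<subseteq> D" using t[OF D] ys eq by (auto simp: zs_def)
    ultimately show "C = D" using span_zs[OF C] span_zs[OF D] by simp
  qed
  ultimately have "card ?S \<le> card T"
    using card_inj_on_le[of f ?S T] finT by simp
  also have "card T = card (frames r A (A \<inter> B)) * CARD('a) ^ (a * (k - r))"
    using fin A by (simp add: T_def card_cartesian_product card_lists_length_eq power_mult)
  finally have "real (card ?S) \<le> real (card (frames r A (A \<inter> B)) * CARD('a) ^ (a * (k - r)))"
    by (rule of_nat_mono)
  then have "real (card ?S) \<le> real (card (frames r A (A \<inter> B))) * ?q ^ (a * (k - r))"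
    by (simp only: of_nat_mult of_nat_power)
  also have "real (card (frames r A (A \<inter> B)))
      = (\<Prod>i<r. ?q ^ a - ?q ^ i * real (card (A \<inter> B)))"
    using card_frames[OF A(1) fin(1) AB] A by simp
  also have "\<dots> = (\<Prod>i<r. ?q ^ a * (1 - 1 / ?q ^ Suc (r - Suc i)))"
  proof (rule prod.cong)
    fix i assume i: "i \<in> {..<r}"
    have "r = i + Suc (r - Suc i)" using i by simp
    then have "?q ^ r = ?q ^ i * ?q ^ Suc (r - Suc i)" by (metis power_add)
    moreover have "?q ^ a = ?q ^ r * real (card (A \<inter> B))"
      using r[THEN arg_cong[where f = real]] by simp
    ultimately show "?q ^ a - ?q ^ i * real (card (A \<inter> B)) = ?q ^ a * (1 - 1 / ?q ^ Suc (r - Suc i))"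
      using q1 by (simp add: field_simps)
  qed simp
  also have "\<dots> = ?q ^ (a * r) * q_poch ?q r"
    unfolding prod.distrib q_poch_def
    using prod.nat_diff_reindex[of "\<lambda>i. 1 - 1 / ?q ^ Suc i" r] by (simp add: power_mult)
  also have "?q ^ (a * r) * q_poch ?q r * ?q ^ (a * (k - r)) = ?q ^ (a * k) * q_poch ?q r"
    using rk by (simp flip: power_add distrib_left)
  finally show ?thesis .
qed

end

section \<open>Spaces of matrices with prescribed column space\<close>

text \<open>
  Vectors of length \<open>n\<close> and \<open>n \<times> m\<close> matrices are represented by functions that vanish outside the
  index range; a matrix is a function of the column index whose values are vectors. Both function
  spaces are vector spaces as types, and the spaces of interest are finite subspaces of them.
\<close>
interpretation vec_fun: finite_field_space "\<lambda>(c::'a::{field,finite}) (v::nat \<Rightarrow> 'a) i. c * v i"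
  by unfold_locales (rule ext, simp add: algebra_simps)+

interpretation mat_fun: finite_field_space
    "\<lambda>(c::'a::{field,finite}) (M::nat \<Rightarrow> nat \<Rightarrow> 'a) j i. c * M j i"
  by unfold_locales ((rule ext)+, simp add: algebra_simps)+

text \<open>
  The matrices with \<open>m\<close> columns, all of which lie in \<open>U\<close>. The same construction with
  \<open>U = UNIV :: 'a set\<close> yields the space of vectors of length \<open>m\<close>.
\<close>
definition col_family :: "nat \<Rightarrow> 'b::zero set \<Rightarrow> (nat \<Rightarrow> 'b) set" where
  "col_family m U = {M. (\<forall>j<m. M j \<in> U) \<and> (\<forall>j\<ge>m. M j = 0)}"

lemma bij_betw_col_family: "bij_betw (\<lambda>M. restrict M {..<m}) (col_family m U) ({..<m} \<rightarrow>\<^sub>E U)"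
proof (rule bij_betw_byWitness[where f' = "\<lambda>f j. if j < m then f j else 0"])
  show "\<forall>M\<in>col_family m U. (\<lambda>j. if j < m then restrict M {..<m} j else 0) = M"
    by (intro ballI ext) (simp add: col_family_def)
  show "\<forall>f\<in>{..<m} \<rightarrow>\<^sub>E U. restrict (\<lambda>j. if j < m then f j else 0) {..<m} = f"
  proof (intro ballI ext)
    fix f j assume "f \<in> {..<m} \<rightarrow>\<^sub>E U"
    then show "restrict (\<lambda>j. if j < m then f j else 0) {..<m} j = f j"
      using PiE_arb[of f "{..<m}" "\<lambda>_. U" j] by (cases "j < m") simp_all
  qed
  show "(\<lambda>M. restrict M {..<m}) ` col_family m U \<subseteq> {..<m} \<rightarrow>\<^sub>E U"
    by (intro image_subsetI restrict_PiE_iff[THEN iffD2]) (simp add: col_family_def)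
  show "(\<lambda>f j. if j < m then f j else 0) ` ({..<m} \<rightarrow>\<^sub>E U) \<subseteq> col_family m U"
    by (intro image_subsetI) (simp add: col_family_def PiE_iff)
qed

lemma card_col_family: "card (col_family m U) = card U ^ m"
  using bij_betw_same_card[OF bij_betw_col_family[of m U]] by (simp add: card_PiE)

lemma finite_col_family: "finite U \<Longrightarrow> finite (col_family m U)"
  using bij_betw_finite[OF bij_betw_col_family[of m U]] by (simp add: finite_PiE)

lemma col_family_Int: "col_family m U \<inter> col_family m U' = col_family m (U \<inter> U')"
  by (auto simp: col_family_def)

lemma col_family_mono: "U \<subseteq> U' \<Longrightarrow> col_family m U \<subseteq> col_family m U'"
  by (auto simp: col_family_def)

lemma subspace_col_family:
  assumes "vec_fun.subspace U"
  shows "mat_fun.subspace (col_family m U)"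
  using assms unfolding mat_fun.subspace_def vec_fun.subspace_def
  by (auto simp: col_family_def zero_fun_def)

lemma subspace_coordinates: "vec_fun.subspace (col_family n UNIV)"
  by (auto simp: vec_fun.subspace_def col_family_def)

text \<open>
  The second moment bound for the subspaces \<open>C\<close> of dimension \<open>m * (n - d + 1)\<close> and the events
  \<open>C \<inter> col_family m U = {0}\<close>, where \<open>U\<close> ranges over the \<open>(d - 1)\<close>-dimensional spaces of columns.
  These are \<open>N\<close> events; each of them contains \<open>e\<close> subspaces, and two different ones have at most
  \<open>e * q_poch q m\<close> subspaces in common.
\<close>
lemma density_count_bound:
  fixes n m d :: nat and L :: real
  defines "q \<equiv> real CARD('a::{field,finite})"
  defines "V \<equiv> col_family n (UNIV :: 'a set)"
  defines "N \<equiv> q_binomial q n (d - 1)" and "k \<equiv> m * (n - d + 1)"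
  defines "e \<equiv> q ^ (m * (d - 1) * k)"
  assumes d: "1 \<le> d" "d \<le> n"
  shows "real (card {C \<in> mat_fun.subspaces k (col_family m V).
        \<forall>U\<in>vec_fun.subspaces (d - 1) V. C \<inter> col_family m U = {0}}) * (N - L)\<^sup>2
    \<le> N * e + N * (N - 1) * (e * q_poch q m) - 2 * L * N * e + L\<^sup>2 * q_binomial q (m * n) k"
proof -
  let ?W = "col_family m V" and ?a = "m * (d - 1)"
  have q1: "q > 1" using vec_fun.card_field_gt_1 by (simp add: q_def)
  have V: "vec_fun.subspace V" "finite V" "card V = CARD('a) ^ n"
    by (simp_all add: V_def subspace_coordinates finite_col_family card_col_family)
  have W: "mat_fun.subspace ?W" "finite ?W" "card ?W = CARD('a) ^ (m * n)"
    using V by (simp_all add: subspace_col_family finite_col_family card_col_family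
        mult.commute flip: power_mult)
  have "(d - 1) + (n - d + 1) = n" using d by simp
  then have ak: "m * n = ?a + k" unfolding k_def by (metis distrib_left)
  let ?\<Omega> = "mat_fun.subspaces k ?W" and ?J = "vec_fun.subspaces (d - 1) V"
  let ?E = "\<lambda>U. {C \<in> ?\<Omega>. C \<inter> col_family m U = {0}}"
  have cardJ: "real (card ?J) = N"
    unfolding N_def q_def by (rule vec_fun.card_subspaces[OF V])
  have U: "mat_fun.subspace (col_family m U)" "col_family m U \<subseteq> ?W"
    "card (col_family m U) = CARD('a) ^ ?a" if "U \<in> ?J" for U
    using vec_fun.subspacesD[OF that V(2)]
    by (simp_all add: subspace_col_family col_family_mono card_col_family mult.commute
        flip: power_mult)
  have E1: "real (card (?E U)) = e" if "U \<in> ?J" for U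
    unfolding e_def q_def
    using mat_fun.card_complements[OF W(1,2) _ U[OF that], of k] W ak by simp
  have E2: "real (card (?E U \<inter> ?E U')) \<le> e * q_poch q m"
    if UU: "U \<in> ?J" "U' \<in> ?J" "U \<noteq> U'" for U U'
  proof -
    note D = vec_fun.subspacesD[OF UU(1) V(2)] vec_fun.subspacesD[OF UU(2) V(2)]
    have sI: "vec_fun.subspace (U \<inter> U')" using D vec_fun.subspace_inter by blast
    then obtain t where t: "card U = CARD('a) ^ t * card (U \<inter> U')"
      using vec_fun.subspace_tower[of U "U \<inter> U'"] D by auto
    \<comment> \<open>\<open>U \<inter> U'\<close> has codimension at least 1 in \<open>U\<close>, so the two spaces of matrices intersect in
      codimension at least \<open>m\<close>.\<close>
    have "t \<noteq> 0"
    proof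
      assume "t = 0"
      then have "U \<inter> U' = U" using t D by (intro card_subset_eq) auto
      then have "U \<subseteq> U'" by blast
      then have "U = U'" using D by (intro card_subset_eq) auto
      then show False using UU by simp
    qed
    have r: "CARD('a) ^ ?a = CARD('a) ^ (m * t) * card (col_family m U \<inter> col_family m U')"
    proof -
      have "CARD('a) ^ ?a = (card U) ^ m" using D by (simp add: mult.commute flip: power_mult)
      also have "\<dots> = CARD('a) ^ (m * t) * card (U \<inter> U') ^ m"
        by (simp add: t power_mult_distrib mult.commute flip: power_mult)
      finally show ?thesis by (simp add: col_family_Int card_col_family)
    qed
    have "?E U \<inter> ?E U' = {C \<in> ?\<Omega>. C \<inter> col_family m U = {0} \<and> C \<inter> col_family m U' = {0}}"
      by (intro Set.set_eqI, simp only: Int_iff mem_Collect_eq) argo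
    then have "real (card (?E U \<inter> ?E U')) \<le> e * q_poch q (m * t)"
      using mat_fun.card_common_complements_le[OF W(1,2) _ U[OF UU(1)] U[OF UU(2)] r, of k] W ak
      unfolding e_def q_def by simp
    also have "\<dots> \<le> e * q_poch q m"
      using q1 \<open>t \<noteq> 0\<close> by (intro mult_left_mono q_poch_antimono) (auto simp: e_def)
    finally show ?thesis .
  qed
  have "real (card {C \<in> ?\<Omega>. \<forall>U\<in>?J. C \<in> ?E U}) * (real (card ?J) - L)\<^sup>2
    \<le> real (card ?J) * e + real (card ?J) * (real (card ?J) - 1) * (e * q_poch q m)
      - 2 * L * real (card ?J) * e + L\<^sup>2 * real (card ?\<Omega>)"
  proof (rule second_moment_bound)
    show "finite ?\<Omega>" by (rule mat_fun.finite_subspaces[OF W(2)])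
    show "finite ?J" by (rule vec_fun.finite_subspaces[OF V(2)])
    show "?E U \<subseteq> ?\<Omega>" for U by (rule Collect_restrict)
  qed (fact E1, fact E2)
  moreover have "real (card ?\<Omega>) = q_binomial q (m * n) k"
    unfolding q_def by (rule mat_fun.card_subspaces[OF W])
  moreover have "{C \<in> ?\<Omega>. \<forall>U\<in>?J. C \<in> ?E U} = {C \<in> ?\<Omega>. \<forall>U\<in>?J. C \<inter> col_family m U = {0}}"
    by (intro Set.set_eqI, simp only: mem_Collect_eq) meson
  ultimately show ?thesis by (simp only: cardJ)
qed

section \<open>Codes as subspaces of a function space\<close>

lemma card_carrier_eq_power_dim:
  assumes "vectorspace (class_ring :: 'a::{field,finite} ring) V" and fin: "finite (carrier V)"
  shows "card (carrier V) = CARD('a) ^ vectorspace.dim (class_ring :: 'a ring) V"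
proof -
  interpret V: vectorspace "class_ring :: 'a ring" V by fact
  have "V.span (carrier V) = carrier V"
    using V.in_own_span[of "carrier V"] V.span_is_subset2[of "carrier V"] by auto
  then have "V.fin_dim" unfolding V.fin_dim_def using fin by auto
  then obtain B where B: "finite B" "V.basis B" using V.finite_basis_exists by blast
  have BV: "B \<subseteq> carrier V" using B by (simp add: V.basis_def)
  have ex: "\<exists>!a. a \<in> B \<rightarrow>\<^sub>E UNIV \<and> V.lincomb a B = v" if "v \<in> carrier V" for v
    using V.basis_criterion[OF B(1) BV] B(2) that by (simp add: class_ring_simps)
  have "bij_betw (\<lambda>a. V.lincomb a B) (B \<rightarrow>\<^sub>E UNIV) (carrier V)"
    unfolding bij_betw_def
  proof
    have cl: "V.lincomb a B \<in> carrier V" for a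
      using BV by (intro V.lincomb_closed) (auto simp: class_ring_simps)
    then show "inj_on (\<lambda>a. V.lincomb a B) (B \<rightarrow>\<^sub>E UNIV)"
      using ex by (intro inj_onI) metis
    show "(\<lambda>a. V.lincomb a B) ` (B \<rightarrow>\<^sub>E UNIV) = carrier V"
    proof
      show "(\<lambda>a. V.lincomb a B) ` (B \<rightarrow>\<^sub>E UNIV) \<subseteq> carrier V" using cl by blast
      show "carrier V \<subseteq> (\<lambda>a. V.lincomb a B) ` (B \<rightarrow>\<^sub>E UNIV)"
      proof
        fix v assume "v \<in> carrier V"
        then obtain a where "a \<in> B \<rightarrow>\<^sub>E UNIV" "V.lincomb a B = v" using ex by meson
        then show "v \<in> (\<lambda>a. V.lincomb a B) ` (B \<rightarrow>\<^sub>E UNIV)" by blast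
      qed
    qed
  qed
  then have "card (B \<rightarrow>\<^sub>E (UNIV :: 'a set)) = card (carrier V)" by (rule bij_betw_same_card)
  then show ?thesis
    unfolding V.dim_basis[OF B] using B(1) by (simp add: card_PiE)
qed

text \<open>
  The passage from vectors and matrices to functions of the indices, extended by \<open>0\<close>. The matrix
  function takes the column index first.
\<close>
definition vec_entries :: "'a::zero vec \<Rightarrow> nat \<Rightarrow> 'a" where
  "vec_entries v = (\<lambda>i. if i < dim_vec v then v $ i else 0)"

definition mat_entries :: "'a::zero mat \<Rightarrow> nat \<Rightarrow> nat \<Rightarrow> 'a" where
  "mat_entries M = (\<lambda>j. if j < dim_col M then vec_entries (col M j) else 0)"

lemma mat_entries_apply:
  "M \<in> carrier_mat n m \<Longrightarrow> mat_entries M j i = (if j < m \<and> i < n then M $$ (i, j) else 0)"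
  by (simp add: mat_entries_def vec_entries_def)

lemma inj_on_vec_entries: "inj_on vec_entries (carrier_vec n)"
proof (rule inj_onI)
  fix v w :: "'a vec" assume v: "v \<in> carrier_vec n" and w: "w \<in> carrier_vec n"
    and eq: "vec_entries v = vec_entries w"
  show "v = w"
  proof (rule eq_vecI)
    fix i assume "i < dim_vec w"
    then show "v $ i = w $ i" using fun_cong[OF eq, of i] v w by (simp add: vec_entries_def)
  qed (use v w in simp)
qed

lemma inj_on_mat_entries: "inj_on mat_entries (carrier_mat n m)"
proof (rule inj_onI)
  fix A B :: "'a mat" assume A: "A \<in> carrier_mat n m" and B: "B \<in> carrier_mat n m"
    and eq: "mat_entries A = mat_entries B"
  show "A = B"
  proof (rule eq_matI)
    fix i j assume "i < dim_row B" "j < dim_col B"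
    then show "A $$ (i, j) = B $$ (i, j)"
      using fun_cong[OF fun_cong[OF eq, of j], of i] A B by (simp add: mat_entries_apply)
  qed (use A B in simp_all)
qed

lemma mat_entries_in_col_family:
  "M \<in> carrier_mat n m \<Longrightarrow> mat_entries M \<in> col_family m (col_family n UNIV)"
  by (simp add: col_family_def mat_entries_def vec_entries_def zero_fun_def)

lemma subspace_mat_entries_image:
  fixes C :: "'a::{field,finite} mat set"
  assumes "subspace class_ring C (module_mat TYPE('a) n m)"
  shows "mat_fun.subspace (mat_entries ` C)"
proof -
  have sub: "submodule class_ring C (module_mat TYPE('a) n m)"
    using assms by (simp add: subspace_def)
  note C = submodule.subset[OF sub] submodule.m_closed[OF sub] submodule.zero_closed[OF sub]
    submodule.smult_closed[OF sub]
  have carr: "A \<in> carrier_mat n m" if "A \<in> C" for A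
    using C(1) that by (auto simp: module_mat_simps)
  show ?thesis
    unfolding mat_fun.subspace_def
  proof (intro conjI ballI allI)
    have "0\<^sub>m n m \<in> C" using C(3) by (simp add: module_mat_simps)
    moreover have "mat_entries (0\<^sub>m n m :: 'a mat) = 0"
      by (intro ext) (simp add: mat_entries_apply[OF zero_carrier_mat])
    ultimately show "0 \<in> mat_entries ` C" by (metis imageI)
  next
    fix x y assume "x \<in> mat_entries ` C" "y \<in> mat_entries ` C"
    then obtain A B where AB: "A \<in> C" "B \<in> C" "x = mat_entries A" "y = mat_entries B" by blast
    have "A + B \<in> C" using C(2)[OF AB(1,2)] by (simp add: module_mat_simps)
    moreover have "mat_entries (A + B) = x + y"
      using carr[OF AB(1)] carr[OF AB(2)] AB(3,4)
      by (intro ext) (simp add: mat_entries_apply[of _ n m])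
    ultimately show "x + y \<in> mat_entries ` C" by (metis imageI)
  next
    fix c x assume "x \<in> mat_entries ` C"
    then obtain A where A: "A \<in> C" "x = mat_entries A" by blast
    have "c \<cdot>\<^sub>m A \<in> C" using C(4)[of c A] A by (simp add: module_mat_simps class_ring_simps)
    moreover have "mat_entries (c \<cdot>\<^sub>m A) = (\<lambda>j i. c * x j i)"
      using carr[OF A(1)] A(2)
      by (intro ext) (simp add: mat_entries_apply[of _ n m])
    ultimately show "(\<lambda>j i. c * x j i) \<in> mat_entries ` C" by (metis imageI)
  qed
qed

lemma mat_rank_le_of_cols:
  fixes U :: "(nat \<Rightarrow> 'a::{field,finite}) set"
  assumes M: "M \<in> carrier_mat n m" and U: "vec_fun.subspace U" "finite U" "card U = CARD('a) ^ r"
    and MU: "mat_entries M \<in> col_family m U"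
  shows "mat_rank M \<le> r"
proof -
  interpret vec_space "TYPE('a)" n .
  define P where "P = {v \<in> carrier_vec n. vec_entries v \<in> U}"
  have add: "vec_entries (v + w) = vec_entries v + vec_entries w"
    if "v \<in> carrier_vec n" "w \<in> carrier_vec n" for v w :: "'a vec"
    using that by (intro ext) (simp add: vec_entries_def)
  have smult: "vec_entries (c \<cdot>\<^sub>v v) = (\<lambda>i. c * vec_entries v i)" for c and v :: "'a vec"
    by (intro ext) (simp add: vec_entries_def)
  have zero: "vec_entries (0\<^sub>v n :: 'a vec) = 0"
    by (intro ext) (simp add: vec_entries_def)
  have P: "submodule class_ring P V"
  proof
    show "P \<subseteq> carrier V" by (auto simp: P_def module_vec_simps)
    show "v \<oplus>\<^bsub>V\<^esub> w \<in> P" if "v \<in> P" "w \<in> P" for v w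
      using that vec_fun.subspace_add[OF U(1)] by (simp add: P_def module_vec_simps add)
    show "\<zero>\<^bsub>V\<^esub> \<in> P"
      using vec_fun.subspace_0[OF U(1)] by (simp add: P_def module_vec_simps zero)
    show "c \<odot>\<^bsub>V\<^esub> v \<in> P" if "c \<in> carrier class_ring" "v \<in> P" for c v
      using that vec_fun.subspace_scale[OF U(1)] by (simp add: P_def module_vec_simps smult)
  qed
  have cols: "set (cols M) \<subseteq> P"
  proof
    fix v assume "v \<in> set (cols M)"
    then obtain j where j: "j < m" "v = col M j" using M by (auto simp: cols_def)
    have "mat_entries M j \<in> U" using MU j by (simp add: col_family_def)
    then show "v \<in> P" using j M by (simp add: P_def mat_entries_def)
  qed
  let ?S = "span (set (cols M))"
  have SP: "?S \<subseteq> P" by (rule span_is_subset[OF cols P])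
  have inj: "inj_on vec_entries ?S"
    using inj_on_vec_entries by (rule inj_on_subset) (use SP in \<open>auto simp: P_def\<close>)
  have img: "vec_entries ` ?S \<subseteq> U" using SP by (auto simp: P_def)
  have finS: "finite ?S" using inj img U(2) inj_on_finite by blast
  have "set (cols M) \<subseteq> carrier_vec n" using cols by (auto simp: P_def)
  then have "vectorspace class_ring (span_vs (set (cols M)))"
    by (intro subspace_is_vs span_is_subspace)
  then have "card ?S = CARD('a) ^ rank M"
    using card_carrier_eq_power_dim[of "span_vs (set (cols M))"] finS by (simp add: rank_def)
  moreover have "card ?S \<le> card U" by (rule card_inj_on_le[OF inj img U(2)])
  ultimately have "CARD('a) ^ rank M \<le> CARD('a) ^ r" using U(3) by simp
  then have "rank M \<le> r" using vec_fun.card_field_gt_1 power_le_imp_le_exp by blast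
  then show ?thesis using M by (simp add: mat_rank_def)
qed

text \<open>
  A code whose nonzero elements have rank at least \<open>d\<close> contains no nonzero matrix with all columns in
  a space of dimension \<open>d - 1\<close>.
\<close>
lemma card_codes_le:
  "card {C :: 'a::{field,finite} mat set.
      rank_metric_code n m C \<and> code_dim n m C = k \<and> min_distance n m C \<ge> d}
    \<le> card {D \<in> mat_fun.subspaces k (col_family m (col_family n (UNIV :: 'a set))).
        \<forall>U\<in>vec_fun.subspaces (d - 1) (col_family n UNIV). D \<inter> col_family m U = {0}}"
    (is "card ?C \<le> card ?D")
  if "d \<ge> 1"
proof (rule card_inj_on_le)
  let ?V = "col_family n (UNIV :: 'a set)"
  have finV: "finite ?V" by (simp add: finite_col_family)
  show "finite ?D"
    using mat_fun.finite_subspaces[OF finite_col_family[OF finV]] by simp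
  have carr: "C \<subseteq> carrier_mat n m" if "C \<in> ?C" for C
    using that submodule.subset[of class_ring C "module_mat TYPE('a) n m"]
    by (simp add: rank_metric_code_def subspace_def module_mat_simps)
  show "inj_on ((`) mat_entries) ?C"
    using carr by (intro inj_onI) (meson inj_on_mat_entries inj_on_image_eq_iff)
  show "(`) mat_entries ` ?C \<subseteq> ?D"
  proof (rule image_subsetI)
    fix C assume C: "C \<in> ?C"
    then have sub: "subspace class_ring C (module_mat TYPE('a) n m)"
      and dim: "code_dim n m C = k" and dist: "min_distance n m C \<ge> d"
      by (auto simp: rank_metric_code_def)
    have inj: "inj_on mat_entries C" using inj_on_mat_entries carr[OF C] inj_on_subset by blast
    have img: "mat_entries ` C \<subseteq> col_family m ?V"
      using mat_entries_in_col_family carr[OF C] by blast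
    have finC: "finite C"
      using inj img finite_col_family[OF finV] inj_on_finite by blast
    have "vectorspace class_ring ((module_mat TYPE('a) n m)\<lparr>carrier := C\<rparr>)"
      using vectorspace.subspace_is_vs[OF matrix_vs sub] .
    then have "card C = CARD('a) ^ k"
      using card_carrier_eq_power_dim[of "(module_mat TYPE('a) n m)\<lparr>carrier := C\<rparr>"] finC dim
      by (simp add: code_dim_def)
    then have "mat_entries ` C \<in> mat_fun.subspaces k (col_family m ?V)"
      using subspace_mat_entries_image[OF sub] img inj
      by (simp add: mat_fun.subspaces_def card_image)
    moreover have "mat_entries ` C \<inter> col_family m U = {0}"
      if U: "U \<in> vec_fun.subspaces (d - 1) ?V" for U
    proof -
      note U' = vec_fun.subspacesD[OF U finV]
      have "0 \<in> mat_entries ` C \<inter> col_family m U"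
        using mat_fun.subspace_0[OF subspace_mat_entries_image[OF sub]]
          mat_fun.subspace_0[OF subspace_col_family[OF U'(1)]] by blast
      moreover have "mat_entries M = 0" if M: "M \<in> C" "mat_entries M \<in> col_family m U" for M
      proof (rule ccontr)
        assume nz: "mat_entries M \<noteq> 0"
        have "mat_entries (0\<^sub>m n m :: 'a mat) = 0"
          by (intro ext) (simp add: mat_entries_apply[OF zero_carrier_mat])
        then have "M \<noteq> 0\<^sub>m n m" using nz by metis
        then have "mat_rank M \<in> {mat_rank M | M. M \<in> C \<and> M \<noteq> 0\<^sub>m n m}" using M by blast
        moreover have "finite {mat_rank M | M. M \<in> C \<and> M \<noteq> 0\<^sub>m n m}" using finC by simp
        ultimately have "min_distance n m C \<le> mat_rank M"
          unfolding min_distance_def by (rule Min_le[rotated])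
        moreover have "mat_rank M \<le> d - 1"
          using mat_rank_le_of_cols[of M n m U "d - 1"] carr[OF C] M U' by blast
        ultimately show False using dist \<open>d \<ge> 1\<close> by linarith
      qed
      ultimately show ?thesis by blast
    qed
    ultimately show "mat_entries ` C \<in> ?D" by simp
  qed
qed

section \<open>The density bound and its limit\<close>

text \<open>
  Division of the second moment bound by the number of all subspaces of the given dimension. Here
  \<open>\<alpha>\<close> is the probability that a random one is a complement of a fixed space of dimension \<open>a\<close>.
\<close>
lemma code_density_le:
  fixes n m d :: nat and L :: real
  defines "q \<equiv> real CARD('a::{field,finite})"
  defines "N \<equiv> q_binomial q n (d - 1)" and "a \<equiv> m * (d - 1)" and "k \<equiv> m * (n - d + 1)"
  defines "\<alpha> \<equiv> q_poch q a * q_poch q k / q_poch q (a + k)"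
  assumes d: "1 \<le> d" "d \<le> n" and L: "N \<noteq> L"
  shows "code_density TYPE('a) n m k d
    \<le> (N * \<alpha> + N * (N - 1) * (\<alpha> * q_poch q m) - 2 * L * N * \<alpha> + L\<^sup>2) / (N - L)\<^sup>2"
proof -
  have q1: "q > 1" using vec_fun.card_field_gt_1 by (simp add: q_def)
  have "(d - 1) + (n - d + 1) = n" using d by simp
  then have ak: "m * n = a + k" unfolding k_def a_def by (metis distrib_left)
  define Q where "Q = q_binomial q (m * n) k"
  have Q: "Q = q ^ (a * k) * q_poch q (a + k) / (q_poch q a * q_poch q k)"
    unfolding Q_def ak by (rule q_binomial_eq_q_poch[OF q1])
  have Q0: "Q > 0" unfolding Q using q_poch_pos[OF q1] q1 by simp
  have e: "q ^ (a * k) = \<alpha> * Q"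
    unfolding Q \<alpha>_def using q_poch_pos[OF q1, THEN less_imp_neq] by (simp add: field_simps)
  let ?c = "real (card {C :: 'a mat set.
      rank_metric_code n m C \<and> code_dim n m C = k \<and> min_distance n m C \<ge> d})"
  have "?c * (N - L)\<^sup>2 \<le> real (card {D \<in> mat_fun.subspaces k (col_family m (col_family n (UNIV :: 'a set))).
        \<forall>U\<in>vec_fun.subspaces (d - 1) (col_family n UNIV). D \<inter> col_family m U = {0}}) * (N - L)\<^sup>2"
    using card_codes_le[OF d(1)] by (intro mult_right_mono) simp_all
  also have "\<dots> \<le> N * q ^ (a * k) + N * (N - 1) * (q ^ (a * k) * q_poch q m)
      - 2 * L * N * q ^ (a * k) + L\<^sup>2 * Q"
    using density_count_bound[OF d, where ?'a = 'a and m = m and L = L]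
    unfolding N_def a_def k_def q_def Q_def by blast
  also have "\<dots> = (N * \<alpha> + N * (N - 1) * (\<alpha> * q_poch q m) - 2 * L * N * \<alpha> + L\<^sup>2) * Q"
    unfolding e by (simp add: algebra_simps)
  finally have "?c * (N - L)\<^sup>2
    \<le> (N * \<alpha> + N * (N - 1) * (\<alpha> * q_poch q m) - 2 * L * N * \<alpha> + L\<^sup>2) * Q" .
  moreover have "(N - L)\<^sup>2 > 0" using L by simp
  moreover have "code_density TYPE('a) n m k d = ?c / Q"
    by (simp add: code_density_def Q_def q_def)
  ultimately have "code_density TYPE('a) n m k d * (N - L)\<^sup>2 * Q
    \<le> (N * \<alpha> + N * (N - 1) * (\<alpha> * q_poch q m) - 2 * L * N * \<alpha> + L\<^sup>2) * Q"
    using Q0 by (simp add: mult_ac)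
  then have "code_density TYPE('a) n m k d * (N - L)\<^sup>2
    \<le> N * \<alpha> + N * (N - 1) * (\<alpha> * q_poch q m) - 2 * L * N * \<alpha> + L\<^sup>2"
    using Q0 by (rule mult_right_le_imp_le)
  then show ?thesis using \<open>(N - L)\<^sup>2 > 0\<close> by (simp only: pos_le_divide_eq)
qed

theorem theorem6p6:
  fixes q n d :: nat
  assumes "primepow q"
    and "CARD('a :: {finite, field}) = q"
    and "n \<ge> 2"
    and "2 \<le> d" and "d \<le> n"
  shows "limsup (\<lambda>m. ereal (code_density TYPE('a) n m (m * (n - d + 1)) d))
    \<le> ereal (1 / (q_binomial (real q) n (d - 1) * (q_pi (real q) - 1) + 1))"
proof -
  let ?q = "real q"
  define N where "N = q_binomial ?q n (d - 1)"
  define p where "p = q_pi ?q"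
  define L where "L = (N - 1) / p"
  define \<alpha> where "\<alpha> m = q_poch ?q (m * (d - 1)) * q_poch ?q (m * (n - d + 1))
    / q_poch ?q (m * (d - 1) + m * (n - d + 1))" for m
  define b where "b m = (N * \<alpha> m + N * (N - 1) * (\<alpha> m * q_poch ?q m) - 2 * L * N * \<alpha> m + L\<^sup>2)
    / (N - L)\<^sup>2" for m
  have q1: "?q > 1" using vec_fun.card_field_gt_1[where ?'a = 'a] assms(2) by simp
  have p: "p \<ge> 1" unfolding p_def by (rule q_pi_ge_1[OF q1])
  have lim: "q_poch ?q \<longlonglongrightarrow> 1 / p" unfolding p_def by (rule q_poch_tendsto[OF q1])
  have N: "N \<ge> 1"
  proof -
    let ?V = "col_family n (UNIV :: 'a set)"
    have "real (card (vec_fun.subspaces (d - 1) ?V)) = N"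
      unfolding N_def assms(2)[symmetric]
      by (intro vec_fun.card_subspaces)
        (simp_all add: subspace_coordinates finite_col_family card_col_family)
    moreover have "N > 0"
      using q_binomial_eq_q_poch[OF q1, of "n - (d - 1)" "d - 1"] q_poch_pos[OF q1] q1 assms
      by (simp add: N_def)
    ultimately have "card (vec_fun.subspaces (d - 1) ?V) \<ge> 1" by (simp add: Suc_le_eq)
    then show ?thesis using \<open>real (card (vec_fun.subspaces (d - 1) ?V)) = N\<close> by linarith
  qed
  \<comment> \<open>\<open>N - L\<close> equals \<open>(N * (p - 1) + 1) / p\<close>.\<close>
  have "N * (p - 1) \<ge> 0" using N p by simp
  then have "N - L > 0" using p by (simp add: L_def field_simps)
  then have le: "code_density TYPE('a) n m (m * (n - d + 1)) d \<le> b m" for m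
    using code_density_le[where ?'a = 'a, of d n L m] assms
    unfolding b_def \<alpha>_def N_def by simp
  have mult_lim: "(\<lambda>m. q_poch ?q (m * c)) \<longlonglongrightarrow> 1 / p" if "c \<ge> 1" for c
    using lim by (rule filterlim_compose)
      (use that in \<open>auto intro!: filterlim_subseq simp: strict_mono_def\<close>)
  have "\<alpha> \<longlonglongrightarrow> (1 / p) * (1 / p) / (1 / p)"
    unfolding \<alpha>_def distrib_left[symmetric]
    using mult_lim[of "d - 1"] mult_lim[of "n - d + 1"] mult_lim[of "d - 1 + (n - d + 1)"] assms p
    by (intro tendsto_intros) auto
  then have "\<alpha> \<longlonglongrightarrow> 1 / p" using p by simp
  then have "b \<longlonglongrightarrow> 1 / (N * (p - 1) + 1)"
    unfolding b_def by (intro second_moment_limit N p lim L_def)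
  then have "(\<lambda>m. ereal (b m)) \<longlonglongrightarrow> ereal (1 / (N * (p - 1) + 1))" by simp
  then have "limsup (\<lambda>m. ereal (b m)) = ereal (1 / (N * (p - 1) + 1))"
    by (intro lim_imp_Limsup) auto
  moreover have "limsup (\<lambda>m. ereal (code_density TYPE('a) n m (m * (n - d + 1)) d))
    \<le> limsup (\<lambda>m. ereal (b m))"
    using le by (intro Limsup_mono always_eventually) auto
  ultimately show ?thesis by (simp add: N_def p_def)
qed

end
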